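(* Let $s,t$ be real numbers with $s\neq0$, $t\neq0$. For every positive integer $n$, \[ \genfrac{\{}{\}}{0pt}{}{n+2}{2}_{s,t}^2-t^2\genfrac{\{}{\}}{0pt}{}{n+1}{2}_{s,t}^2=\left(\frac{\{n+2\}_{s,t}+t\{n\}_{s,t}}{s}\right)\{n+1\}_{s,t}^3. \]
   Context: The generalized Fibonacci polynomials $\{n\}_{s,t}$ are defined by $\{0\}_{s,t}=0$, $\{1\}_{s,t}=1$, $\{n+2\}_{s,t}=s\{n+1\}_{s,t}+t\{n\}_{s,t}$ (so $\{2\}_{s,t}=s$). The generalized triangular numbers are $\genfrac{\{}{\}}{0pt}{}{m}{2}_{s,t}=\frac{\{m-1\}_{s,t}\{m\}_{s,t}}{\{2\}_{s,t}}$ for integers $m\geq1$. *)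

theory Defs
  imports Complex_Main
begin

fun gfib :: "real \<Rightarrow> real \<Rightarrow> nat \<Rightarrow> real" where
  "gfib s t 0 = 0"
| "gfib s t (Suc 0) = 1"
| "gfib s t (Suc (Suc n)) = s * gfib s t (Suc n) + t * gfib s t n"

(* Meant for m >= 1, where the truncated subtraction m - 1 is the ordinary one. *)
definition gtri :: "real \<Rightarrow> real \<Rightarrow> nat \<Rightarrow> real" where
  "gtri s t m = gfib s t (m - 1) * gfib s t m / gfib s t 2"

end

theory Submission
  imports Defs
begin

text \<open>Both triangular numbers share the factor \<open>gfib s t (n + 1) / s\<close>, so the
  left side is a difference of squares. Its factor \<open>gfib s t (n + 2) - t * gfib s t n\<close>
  equals \<open>s * gfib s t (n + 1)\<close> by the recurrence.\<close>

theorem theorem3: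
  fixes s t :: real and n :: nat
  assumes "s \<noteq> 0" and "t \<noteq> 0" and "n \<ge> 1"
  shows "(gtri s t (n + 2))\<^sup>2 - t\<^sup>2 * (gtri s t (n + 1))\<^sup>2
    = ((gfib s t (n + 2) + t * gfib s t n) / s) * gfib s t (n + 1) ^ 3"
proof -
  define a b c where "a = gfib s t (n + 1)" and "b = gfib s t n" and "c = gfib s t (n + 2)"
  \<comment> \<open>The recurrence, solved for the exact factor that the difference of squares
    produces, so that it can serve as a rewrite rule.\<close>
  have c: "c - t * b = s * a"
    by (simp add: a_def b_def c_def)
  have two: "gfib s t 2 = s"
    by (simp add: numeral_2_eq_2)
  have "(gtri s t (n + 2))\<^sup>2 - t\<^sup>2 * (gtri s t (n + 1))\<^sup>2
      = (a * c / s)\<^sup>2 - t\<^sup>2 * (b * a / s)\<^sup>2"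
    unfolding gtri_def two a_def b_def c_def by simp
  also have "\<dots> = a\<^sup>2 * (c - t * b) * (c + t * b) / s\<^sup>2"
    by (simp add: algebra_simps power2_eq_square diff_divide_distrib)
  \<comment> \<open>Rewriting with the fact \<open>c\<close> supplies the third power of
    \<open>a\<close> and cancels one \<open>s\<close>.\<close>
  also have "\<dots> = ((c + t * b) / s) * a ^ 3"
    unfolding c using \<open>s \<noteq> 0\<close> by (simp add: field_simps power2_eq_square power3_eq_cube)
  finally show ?thesis
    by (simp only: a_def b_def c_def)
qed

end
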